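(* Let $n\ge 1$ and $k\in\{1,\dots,n\}$ be integers, let $g\in C^1(\mathbb{R})$ be nonnegative and nonincreasing, and let $w$ be a radial weight satisfying the standing assumptions on $w$ given in the context, with $\gamma=\lim_{r\to+\infty} r w'(r)/w(r)$. Assume $2k+\gamma>0$ and $$n>\frac{k(k+1)}{2k+\gamma}.$$ Let $u$ be a semi-stable nonconstant radial solution of $S_k(D^2u)=w(|x|)g(u)$ in $\mathbb{R}^n$. Then $|\nabla u(x)|>0$ for all $x\in\mathbb{R}^n$ with $|x|>0$.
   Context: Radial functions are identified with functions of $r=|x|$, and $'$ denotes the derivative with respect to $r$. $k$-Hessian: $S_k(D^2u)$ is the sum of all $k$-th principal minors of the Hessian matrix $D^2u$, equivalently the $k$-th elementary symmetric polynomial of the eigenvalues of $D^2u$. Set $c_{n,k}=\binom{n}{k}/n$. Solutions: solutions are always taken in the class of $k$-admissible ($k$-convex) functions $\Phi^k=\{u\in C^2(\mathbb{R}^n): S_l(D^2u)\ge 0,\ l=1,\dots,k\}$. A radial solution is a radially symmetric $u\in\Phi^k$ satisfying the equation in $\mathbb{R}^n$. Semi-stability: a radial solution $u\in\Phi^k$ is semi-stable if $$\mathcal{Q}_u(\xi):=\int_{\mathbb{R}^n}\Big\{k c_{n,k}|x|^{1-k}|\nabla u|^{k-1}|\nabla \xi|^2+w(|x|)g'(u)\xi^2\Big\}\,dx\ \ge 0$$ for every radially symmetric $\xi\in C_c^1(\mathbb{R}^n)$. Standing assumptions on $w$: $w$ is a nonnegative radial function, positive for $r>0$; put $W(r)=\frac{r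 w'(r)}{w(r)}$. The functions $w$ and $W$ belong to $C^1(\mathbb{R}^n\setminus\{0\})$, $W$ is nonincreasing on $(0,\infty)$, and the limits $\Gamma=\lim_{r\to0}W(r)$ and $\gamma=\lim_{r\to+\infty}W(r)$ are finite. *)

theory Defs
  imports "HOL-Analysis.Analysis"
begin

text \<open>Continuous differentiability on an open set \<open>S\<close>; the derivative map is continuous
  with respect to the operator norm.\<close>

definition C1_on :: "'a::real_normed_vector set \<Rightarrow> ('a \<Rightarrow> 'b::real_normed_vector) \<Rightarrow> bool" where
  "C1_on S f \<longleftrightarrow>
     (\<exists>f'. (\<forall>x\<in>S. (f has_derivative blinfun_apply (f' x)) (at x)) \<and> continuous_on S f')"

definition grad :: "(real ^ 'n \<Rightarrow> real) \<Rightarrow> real ^ 'n \<Rightarrow> real ^ 'n::finite" where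
  "grad u x = (\<chi> i. frechet_derivative u (at x) (axis i 1))"

definition hessian :: "(real ^ 'n \<Rightarrow> real) \<Rightarrow> real ^ 'n \<Rightarrow> real ^ 'n ^ 'n::finite" where
  "hessian u x = jacobian (grad u) (at x)"

definition C2 :: "(real ^ 'n::finite \<Rightarrow> real) \<Rightarrow> bool" where
  "C2 u \<longleftrightarrow> C1_on UNIV u \<and> C1_on UNIV (grad u)"

text \<open>The determinant, by the Leibniz formula, of the submatrix of \<open>A\<close> with rows and
  columns in \<open>I\<close>; compare \<open>det_def\<close>.\<close>

definition principal_minor :: "real ^ 'n ^ 'n::finite \<Rightarrow> 'n set \<Rightarrow> real" where
  "principal_minor A I = (\<Sum>p | p permutes I. of_int (sign p) * (\<Prod>i\<in>I. A $ i $ p i))"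

lemma principal_minor_UNIV: "principal_minor A UNIV = det A"
  by (simp add: principal_minor_def det_def)

definition S_minors :: "nat \<Rightarrow> real ^ 'n ^ 'n::finite \<Rightarrow> real" where
  "S_minors k A = (\<Sum>I | card I = k. principal_minor A I)"

definition admissible :: "nat \<Rightarrow> (real ^ 'n::finite \<Rightarrow> real) set" where
  "admissible k = {u. C2 u \<and> (\<forall>l\<in>{1..k}. \<forall>x. 0 \<le> S_minors l (hessian u x))}"

definition radial :: "('a::real_normed_vector \<Rightarrow> 'b) \<Rightarrow> bool" where
  "radial f \<longleftrightarrow> (\<forall>x y. norm x = norm y \<longrightarrow> f x = f y)"

definition radial_solution ::
  "nat \<Rightarrow> (real \<Rightarrow> real) \<Rightarrow> (real \<Rightarrow> real) \<Rightarrow> (real ^ 'n::finite \<Rightarrow> real) \<Rightarrow> bool" where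
  "radial_solution k w g u \<longleftrightarrow>
     radial u \<and> u \<in> admissible k \<and> (\<forall>x. S_minors k (hessian u x) = w (norm x) * g (u x))"

definition c_nk :: "nat \<Rightarrow> nat \<Rightarrow> real" where
  "c_nk n k = real (n choose k) / real n"

definition Q_integrand ::
  "nat \<Rightarrow> (real \<Rightarrow> real) \<Rightarrow> (real \<Rightarrow> real) \<Rightarrow> (real ^ 'n::finite \<Rightarrow> real)
    \<Rightarrow> (real ^ 'n \<Rightarrow> real) \<Rightarrow> real ^ 'n \<Rightarrow> real" where
  "Q_integrand k w g u \<xi> x =
     real k * c_nk CARD('n) k * norm x powi (1 - int k) * norm (grad u x) ^ (k - 1)
         * (norm (grad \<xi> x))\<^sup>2
       + w (norm x) * deriv g (u x) * (\<xi> x)\<^sup>2"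

text \<open>For radial C2 functions \<open>u\<close> the first summand of the integrand is integrable (the
  gradient vanishes at 0 to first order), and for nonincreasing \<open>g\<close> the
  second is nonpositive, so the integral always exists in \<open>[-\<infinity>, \<infinity>)\<close>. The
  integrability conjunct rules out the value \<open>-\<infinity>\<close>, for which the Bochner integral would
  return 0.\<close>

definition semi_stable ::
  "nat \<Rightarrow> (real \<Rightarrow> real) \<Rightarrow> (real \<Rightarrow> real) \<Rightarrow> (real ^ 'n::finite \<Rightarrow> real) \<Rightarrow> bool" where
  "semi_stable k w g u \<longleftrightarrow>
     (\<forall>\<xi>. radial \<xi> \<and> C1_on UNIV \<xi> \<and> compact (closure {x. \<xi> x \<noteq> 0}) \<longrightarrow>
        integrable lborel (Q_integrand k w g u \<xi>) \<and>
        0 \<le> (LINT x|lborel. Q_integrand k w g u \<xi> x))"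

definition W_weight :: "(real \<Rightarrow> real) \<Rightarrow> real \<Rightarrow> real" where
  "W_weight w r = r * deriv w r / w r"

end

theory Submission imports Defs
begin

text \<open>
  For radial \<open>u\<close> write \<open>\<nabla>u(x) = h(|x|) x\<close>. The Hessian at \<open>x\<close> has the eigenvalues
  \<open>h + r h'\<close> (once) and \<open>h\<close> (\<open>n - 1\<close> times), so \<open>k S\<^sub>k(D\<^sup>2u)\<close> is a positive multiple of
  \<open>r\<^bsup>1-n\<^esup> (r\<^sup>n h\<^sup>k)'\<close>. For \<open>l = 1\<close>, admissibility yields \<open>h \<ge> 0\<close>, so \<open>u\<close> is radially nondecreasing.
  If \<open>h(r\<^sub>0) = 0\<close>, then \<open>h'(r\<^sub>0) = 0\<close> as well because \<open>r\<^sub>0\<close> is a minimum of \<open>h\<close>, so the equation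
  gives \<open>g(u) = 0\<close> at radius \<open>r\<^sub>0\<close>. As \<open>g\<close> is nonnegative and nonincreasing, \<open>g(u)\<close> vanishes at all larger
  radii, where \<open>r\<^sup>n h\<^sup>k\<close> is thus constant, equal to \<open>0\<close>; at smaller radii
  it is squeezed between \<open>0\<close> and its value at \<open>r\<^sub>0\<close>. Hence \<open>h = 0\<close> and \<open>u\<close> is constant.
\<close>

section \<open>Sums of principal minors of diagonal matrices\<close>

text \<open>A permutation of \<open>I\<close> other than the identity moves some \<open>i\<close> in
  \<open>I\<close>, and the off-diagonal factor \<open>A $ i $ p i\<close> kills its Leibniz
  summand.\<close>

lemma principal_minor_diagonal:
  fixes A :: "real ^ 'n ^ 'n::finite"
  assumes "\<And>i j. i \<noteq> j \<Longrightarrow> A $ i $ j = 0"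
  shows "principal_minor A I = (\<Prod>i\<in>I. A $ i $ i)"
proof -
  have fin: "finite {p. p permutes I}" by (simp add: finite_permutations)
  have "of_int (sign p) * (\<Prod>i\<in>I. A $ i $ p i) = 0" if p: "p permutes I" "p \<noteq> id" for p
  proof -
    obtain i where i: "p i \<noteq> i" using p(2) by (auto simp: fun_eq_iff)
    then have "i \<in> I" using p(1) by (auto simp: permutes_def)
    then show ?thesis using assms[of i "p i"] i by (metis finite mult_zero_right prod_zero)
  qed
  then have "principal_minor A I = (\<Sum>p\<in>{id}. of_int (sign p) * (\<Prod>i\<in>I. A $ i $ p i))"
    unfolding principal_minor_def
    by (intro sum.mono_neutral_right[OF fin]) (auto simp: permutes_id)
  then show ?thesis by (simp add: sign_id)
qed

text \<open>The index sets of size \<open>k\<close> are split by whether they contain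
  \<open>m\<close>, the place of the exceptional eigenvalue \<open>a\<close>; the two binomial
  coefficients count the two families.\<close>

lemma S_minors_diagonal:
  fixes A :: "real ^ 'n ^ 'n::finite"
  assumes A: "\<And>i j. A $ i $ j = (if i = j then if i = m then a else b else 0)"
    and k: "1 \<le> k"
  shows "S_minors k A = real ((CARD('n) - 1) choose (k - 1)) * a * b ^ (k - 1)
    + real ((CARD('n) - 1) choose k) * b ^ k"
proof -
  let ?d = "\<lambda>i. if i = m then a else b"
  let ?with = "{I :: 'n set. card I = k \<and> m \<in> I}"
  let ?without = "{I :: 'n set. card I = k \<and> m \<notin> I}"
  have "S_minors k A = (\<Sum>I | card I = k. \<Prod>i\<in>I. ?d i)"
    unfolding S_minors_def by (intro sum.cong refl) (simp add: principal_minor_diagonal A)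
  also have "{I :: 'n set. card I = k} = ?with \<union> ?without" by auto
  also have "(\<Sum>I\<in>?with \<union> ?without. \<Prod>i\<in>I. ?d i)
      = (\<Sum>I\<in>?with. \<Prod>i\<in>I. ?d i) + (\<Sum>I\<in>?without. \<Prod>i\<in>I. ?d i)"
    by (rule sum.union_disjoint) auto
  also have "(\<Sum>I\<in>?without. \<Prod>i\<in>I. ?d i) = (\<Sum>I\<in>?without. b ^ k)"
  proof (rule sum.cong[OF refl])
    fix I assume I: "I \<in> ?without"
    then have "(\<Prod>i\<in>I. ?d i) = (\<Prod>i\<in>I. b)" by (intro prod.cong) auto
    then show "(\<Prod>i\<in>I. ?d i) = b ^ k" using I by simp
  qed
  also have "(\<Sum>I\<in>?with. \<Prod>i\<in>I. ?d i) = (\<Sum>I\<in>?with. a * b ^ (k - 1))"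
  proof (rule sum.cong[OF refl])
    fix I assume I: "I \<in> ?with"
    have "(\<Prod>i\<in>I. ?d i) = a * (\<Prod>i\<in>I - {m}. ?d i)"
      using I by (subst prod.remove[of I m]) auto
    also have "(\<Prod>i\<in>I - {m}. ?d i) = (\<Prod>i\<in>I - {m}. b)" by (intro prod.cong) auto
    finally show "(\<Prod>i\<in>I. ?d i) = a * b ^ (k - 1)" using I by simp
  qed
  also have "card ?without = (CARD('n) - 1) choose k"
  proof -
    have "?without = {I. I \<subseteq> UNIV - {m} \<and> card I = k}" by auto
    then show ?thesis using n_subsets[of "UNIV - {m}" k] by simp
  qed
  moreover have "card ?with = (CARD('n) - 1) choose (k - 1)"
  proof -
    \<comment> \<open>Deleting \<open>m\<close> turns the sets counted here into the
      \<open>(k - 1)\<close>-subsets of the other indices; \<open>1 \<le> k\<close> keeps the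
      cardinalities in step.\<close>
    have "bij_betw (insert m) {I. I \<subseteq> UNIV - {m} \<and> card I = k - 1} ?with"
    proof (rule bij_betw_byWitness[where f' = "\<lambda>I. I - {m}"])
      show "insert m ` {I. I \<subseteq> UNIV - {m} \<and> card I = k - 1} \<subseteq> ?with"
        using k by (auto simp: card_insert_if)
    qed auto
    then show ?thesis
      using n_subsets[of "UNIV - {m}" "k - 1"] by (simp add: bij_betw_same_card[symmetric])
  qed
  ultimately show ?thesis by simp
qed

section \<open>Gradient and Hessian of radial functions\<close>

lemma has_derivative_radial:
  fixes x :: "'a::real_inner"
  assumes "(\<phi> has_real_derivative d) (at (norm x))" and "x \<noteq> 0"
  shows "((\<lambda>y. \<phi> (norm y)) has_derivative (\<lambda>y. d * (x \<bullet> y / norm x))) (at x)"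
proof -
  have "((\<lambda>y. \<phi> (norm y)) has_derivative (\<lambda>y. d * (y \<bullet> sgn x))) (at x)"
    using has_derivative_compose[OF has_derivative_norm[OF assms(2)]
        assms(1)[unfolded has_field_derivative_def]] by simp
  then show ?thesis by (simp add: sgn_div_norm inner_commute divide_inverse mult_ac)
qed

text \<open>Passes from the coordinatewise \<open>grad\<close> and the Jacobian
  \<open>hessian\<close> to Frechet derivatives, to which the chain rule and uniqueness of
  derivatives apply.\<close>

lemma C2_has_derivatives:
  assumes "C2 u"
  shows "(u has_derivative (\<lambda>y. grad u x \<bullet> y)) (at x)"
    and "(grad u has_derivative (\<lambda>y. hessian u x *v y)) (at x)"
proof -
  have du: "u differentiable (at x)" and dg: "grad u differentiable (at x)"
    using assms by (auto simp: C2_def C1_on_def differentiable_def)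
  then have D: "(u has_derivative frechet_derivative u (at x)) (at x)"
    by (simp add: frechet_derivative_works)
  then have lin: "linear (frechet_derivative u (at x))"
    by (rule has_derivative_linear)
  have "frechet_derivative u (at x) = (\<lambda>y. grad u x \<bullet> y)"
  proof
    fix y
    have "frechet_derivative u (at x) y
        = frechet_derivative u (at x) (\<Sum>i\<in>UNIV. y $ i *\<^sub>R axis i 1)"
      by (simp add: basis_expansion[of y] flip: scalar_mult_eq_scaleR)
    then show "frechet_derivative u (at x) y = grad u x \<bullet> y"
      using lin by (simp add: linear_sum linear_cmul grad_def inner_vec_def mult.commute)
  qed
  with D show "(u has_derivative (\<lambda>y. grad u x \<bullet> y)) (at x)"
    by simp
  show "(grad u has_derivative (\<lambda>y. hessian u x *v y)) (at x)"
    using dg jacobian_works unfolding hessian_def by blast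
qed

text \<open>Everything is computed on the ray through a coordinate vector \<open>e\<close>, where
  the Hessian is diagonal. The last clause gives one point on each sphere, which suffices because
  the right-hand side of the equation depends on the norm of \<open>x\<close> only.\<close>

lemma radial_C2_profile:
  fixes u :: "real ^ 'n::finite \<Rightarrow> real"
  assumes "radial u" and "C2 u"
  obtains \<phi> h h' :: "real \<Rightarrow> real" where
    "\<And>x. u x = \<phi> (norm x)"
    "continuous_on {0..} \<phi>"
    "\<And>r. 0 < r \<Longrightarrow> (\<phi> has_real_derivative r * h r) (at r)"
    "\<And>r. 0 < r \<Longrightarrow> (h has_real_derivative h' r) (at r)"
    "((\<lambda>r. r * h r) \<longlongrightarrow> 0) (at_right 0)"
    "\<And>x. x \<noteq> 0 \<Longrightarrow> grad u x = h (norm x) *\<^sub>R x"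
    "\<And>r l. 0 < r \<Longrightarrow> 1 \<le> l \<Longrightarrow> \<exists>x. norm x = r \<and>
       S_minors l (hessian u x)
         = real ((CARD('n) - 1) choose (l - 1)) * (h r + r * h' r) * h r ^ (l - 1)
           + real ((CARD('n) - 1) choose l) * h r ^ l"
proof -
  fix m :: 'n
  define e :: "real ^ 'n" where "e = axis m 1"
  have [simp]: "norm e = 1" by (simp add: e_def)
  have ee[simp]: "e \<bullet> e = 1" by (simp add: e_def inner_axis_axis)
  have e_nz: "e \<noteq> 0" using ee by force
  define \<phi> where "\<phi> = (\<lambda>r. u (r *\<^sub>R e))"
  define \<psi> where "\<psi> = (\<lambda>r. grad u (r *\<^sub>R e) \<bullet> e)"
  define h where "h = (\<lambda>r. \<psi> r / r)"
  define \<psi>' where "\<psi>' = (\<lambda>r. (hessian u (r *\<^sub>R e) *v e) \<bullet> e)"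
  \<comment> \<open>Quotient rule for \<open>\<psi> r / r\<close>, with one factor
    \<open>\<psi> r / r\<close> rewritten as \<open>h r\<close>.\<close>
  define h' where "h' = (\<lambda>r. (\<psi>' r - h r) / r)"
  have u\<phi>: "u x = \<phi> (norm x)" for x
    unfolding \<phi>_def by (rule assms(1)[unfolded radial_def, rule_format]) simp
  have ray: "((\<lambda>r. r *\<^sub>R e) has_derivative (\<lambda>t. t *\<^sub>R e)) (at r)" for r
    by (auto intro!: derivative_eq_intros)
  have d\<phi>: "(\<phi> has_real_derivative \<psi> r) (at r)" for r
    using has_derivative_compose[OF ray C2_has_derivatives(1)[OF assms(2)], of r]
    unfolding has_field_derivative_def \<phi>_def \<psi>_def
    by (simp add: mult_commute_abs)
  have dgrad: "((\<lambda>r. grad u (r *\<^sub>R e)) has_derivative (\<lambda>t. hessian u (r *\<^sub>R e) *v (t *\<^sub>R e))) (at r)"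
    for r
    by (rule has_derivative_compose[OF ray C2_has_derivatives(2)[OF assms(2)]])
  have d\<psi>: "(\<psi> has_real_derivative \<psi>' r) (at r)" for r
    using bounded_linear.has_derivative[OF bounded_linear_inner_left[of e] dgrad[of r]]
    unfolding has_field_derivative_def \<psi>_def \<psi>'_def
    by (simp add: matrix_vector_mult_scaleR mult_commute_abs)
  have \<psi>h: "\<psi> r = r * h r" if "0 < r" for r using that by (simp add: h_def)
  have dh: "(h has_real_derivative h' r) (at r)" if "0 < r" for r
    unfolding h_def h'_def using that
    by (auto intro!: derivative_eq_intros d\<psi> simp: field_simps power2_eq_square)
  \<comment> \<open>Radiality makes \<open>\<phi>\<close>, which is defined on the whole line, even;
    so its derivative at 0 is its own negative.\<close>
  have "\<psi> 0 = 0"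
  proof -
    have "(\<lambda>r. \<phi> (- r)) = \<phi>"
      unfolding \<phi>_def by (rule ext, rule assms(1)[unfolded radial_def, rule_format]) simp
    moreover have "((\<lambda>r. \<phi> (- r)) has_real_derivative \<psi> (- 0) * (- 1)) (at 0)"
      by (rule DERIV_chain2[OF d\<phi>]) (auto intro!: derivative_eq_intros)
    ultimately have "(\<phi> has_real_derivative - \<psi> 0) (at 0)" by simp
    from DERIV_unique[OF d\<phi> this] show ?thesis by simp
  qed
  then have "(\<psi> \<longlongrightarrow> 0) (at 0)" using DERIV_isCont[OF d\<psi>, of 0] by (simp add: isCont_def)
  then have "(\<psi> \<longlongrightarrow> 0) (at_right 0)" using tendsto_mono[OF at_le[OF subset_UNIV]] by blast
  then have lim: "((\<lambda>r. r * h r) \<longlongrightarrow> 0) (at_right 0)"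
    by (rule Lim_transform_eventually) (auto simp: eventually_at_filter \<psi>h)
  have grad: "grad u x = h (norm x) *\<^sub>R x" if "x \<noteq> 0" for x
  proof -
    have "u = (\<lambda>y. \<phi> (norm y))" using u\<phi> by auto
    then have "(u has_derivative (\<lambda>y. \<psi> (norm x) * (x \<bullet> y / norm x))) (at x)"
      using has_derivative_radial[OF d\<phi> that] by simp
    from has_derivative_unique[OF this C2_has_derivatives(1)[OF assms(2)]]
    have "grad u x \<bullet> y = (h (norm x) *\<^sub>R x) \<bullet> y" for y
      by (auto simp: fun_eq_iff h_def field_simps dest: spec[of _ y])
    then show ?thesis using vector_eq_rdot by blast
  qed
  \<comment> \<open>Product rule for \<open>h (norm x) *\<^sub>R x\<close>. This formula for the
    gradient is available off the origin, hence the passage to the open set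
    \<open>- {0}\<close>.\<close>
  have hess: "hessian u (r *\<^sub>R e) *v y = h r *\<^sub>R y + (h' r * (e \<bullet> y) * r) *\<^sub>R e" if "0 < r" for r y
  proof -
    let ?x = "r *\<^sub>R e"
    have nx: "?x \<noteq> 0" "norm ?x = r" using that e_nz by auto
    have "((\<lambda>x. h (norm x)) has_derivative (\<lambda>y. h' r * (?x \<bullet> y / norm ?x))) (at ?x)"
      using has_derivative_radial[of h "h' r" ?x] dh that nx by simp
    then have "((\<lambda>x. h (norm x) *\<^sub>R x) has_derivative
        (\<lambda>y. h (norm ?x) *\<^sub>R y + (h' r * (?x \<bullet> y / norm ?x)) *\<^sub>R ?x)) (at ?x)"
      by (rule has_derivative_scaleR) (rule has_derivative_ident)
    then have "(grad u has_derivative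
        (\<lambda>y. h (norm ?x) *\<^sub>R y + (h' r * (?x \<bullet> y / norm ?x)) *\<^sub>R ?x)) (at ?x)"
      by (rule has_derivative_transform_within_open[where s = "- {0}"])
        (use nx grad in auto)
    from has_derivative_unique[OF C2_has_derivatives(2)[OF assms(2)] this]
    show ?thesis using that nx by (simp add: fun_eq_iff)
  qed
  \<comment> \<open>As \<open>e\<close> is the axis vector of \<open>m\<close>, the rank-one term
    \<open>r * h' r\<close> times \<open>e e^T\<close> touches only the diagonal entry at
    \<open>m\<close>.\<close>
  have entries: "hessian u (r *\<^sub>R e) $ i $ j
      = (if i = j then if i = m then h r + r * h' r else h r else 0)" if "0 < r" for r i j
  proof -
    have "hessian u (r *\<^sub>R e) $ i $ j = (hessian u (r *\<^sub>R e) *v axis j 1) $ i"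
      by (simp add: matrix_vector_mult_basis column_def)
    also have "\<dots> = (if i = j then if i = m then h r + r * h' r else h r else 0)"
    proof -
      have "e \<bullet> axis j 1 = (if j = m then 1 else 0)" by (simp add: e_def inner_axis_axis)
      then show ?thesis unfolding hess[OF that] by (auto simp: e_def axis_def)
    qed
    finally show ?thesis .
  qed
  show thesis
  proof (rule that[OF u\<phi> _ _ dh lim grad])
    show "continuous_on {0..} \<phi>"
      using DERIV_isCont[OF d\<phi>] by (simp add: continuous_at_imp_continuous_on)
    show "(\<phi> has_real_derivative r * h r) (at r)" if "0 < r" for r
      using d\<phi>[of r] \<psi>h[OF that] by simp
    show "\<exists>x. norm x = r \<and> S_minors l (hessian u x)
         = real ((CARD('n) - 1) choose (l - 1)) * (h r + r * h' r) * h r ^ (l - 1)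
           + real ((CARD('n) - 1) choose l) * h r ^ l" if "0 < r" "1 \<le> l" for r l
      using that S_minors_diagonal[OF entries[OF that(1)] that(2)]
      by (intro exI[of _ "r *\<^sub>R e"]) simp
  qed
qed

section \<open>Divergence form of the radial k-Hessian\<close>

text \<open>Pascal's rule and the absorption identity
  \<open>k * (n choose k) = n * ((n - 1) choose (k - 1))\<close> merge the \<open>b ^ k\<close>
  terms. With \<open>b = h r\<close> and \<open>a = r * h' r\<close>, the last bracket is
  \<open>r^(1-n)\<close> times the derivative of \<open>r^n h^k\<close>.\<close>

lemma binomial_radial_identity:
  fixes a b :: real
  assumes "1 \<le> k" and "1 \<le> n"
  shows "real k * (real ((n - 1) choose (k - 1)) * (b + a) * b ^ (k - 1) + real ((n - 1) choose k) * b ^ k)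
    = real ((n - 1) choose (k - 1)) * (real n * b ^ k + real k * a * b ^ (k - 1))"
proof -
  obtain k' n' where [simp]: "k = Suc k'" "n = Suc n'"
    using assms by (metis Suc_le_D One_nat_def)
  have "Suc k' * ((n' choose k') + (n' choose Suc k')) = Suc n' * (n' choose k')"
    using Suc_times_binomial[of k' n'] by simp
  from arg_cong[OF this, of real]
  have "real (Suc k') * (real (n' choose k') + real (n' choose Suc k')) = real (Suc n') * real (n' choose k')"
    by (simp only: of_nat_add of_nat_mult)
  then have "real (Suc k') * (real (n' choose k') + real (n' choose Suc k')) * b ^ k
      = real (Suc n') * real (n' choose k') * b ^ k" by simp
  then show ?thesis by (simp add: algebra_simps)
qed

section \<open>Positivity of the radial derivative away from the origin\<close>

theorem proposition1p2:
  fixes k :: nat and g w :: "real \<Rightarrow> real" and \<Gamma> \<gamma> :: real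
    and u :: "real ^ 'n::finite \<Rightarrow> real"
  assumes "1 \<le> k" and "k \<le> CARD('n)"
    and "C1_on UNIV g" and "\<forall>s. 0 \<le> g s" and "antimono g"
    and "\<forall>r\<ge>0. 0 \<le> w r" and "\<forall>r>0. 0 < w r"
    and "C1_on (- {0}) (\<lambda>x :: real ^ 'n. w (norm x))"
    and "C1_on (- {0}) (\<lambda>x :: real ^ 'n. W_weight w (norm x))"
    and "antimono_on {0<..} (W_weight w)"
    and "(W_weight w \<longlongrightarrow> \<Gamma>) (at_right 0)" and "(W_weight w \<longlongrightarrow> \<gamma>) at_top"
    and "2 * real k + \<gamma> > 0"
    and "real CARD('n) > real k * (real k + 1) / (2 * real k + \<gamma>)"
    and "radial_solution k w g u" and "semi_stable k w g u"
    and "\<not> u constant_on UNIV"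
  shows "\<forall>x. norm x > 0 \<longrightarrow> norm (grad u x) > 0"
proof -
  let ?n = "CARD('n)"
  have n1: "1 \<le> ?n" by (simp add: Suc_leI)
  have rad: "radial u" and adm: "u \<in> admissible k"
    and eq: "S_minors k (hessian u x) = w (norm x) * g (u x)" for x
    using assms(15) by (auto simp: radial_solution_def)
  have "C2 u" using adm by (simp add: admissible_def)
  obtain \<phi> h h' where u\<phi>: "\<And>x. u x = \<phi> (norm x)"
    and c\<phi>: "continuous_on {0..} \<phi>"
    and d\<phi>: "\<And>r. 0 < r \<Longrightarrow> (\<phi> has_real_derivative r * h r) (at r)"
    and dh: "\<And>r. 0 < r \<Longrightarrow> (h has_real_derivative h' r) (at r)"
    and lim: "((\<lambda>r. r * h r) \<longlongrightarrow> 0) (at_right 0)"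
    and grad: "\<And>x. x \<noteq> 0 \<Longrightarrow> grad u x = h (norm x) *\<^sub>R x"
    and S: "\<And>r l. 0 < r \<Longrightarrow> 1 \<le> l \<Longrightarrow> \<exists>x. norm x = r \<and>
       S_minors l (hessian u x)
         = real ((?n - 1) choose (l - 1)) * (h r + r * h' r) * h r ^ (l - 1)
           + real ((?n - 1) choose l) * h r ^ l"
    using radial_C2_profile[OF rad \<open>C2 u\<close>] by blast
  \<comment> \<open>The derivative of \<open>r ^ n * h r ^ l\<close> stripped of its factor
    \<open>r ^ (n - 1)\<close>.\<close>
  define F' where "F' = (\<lambda>l r. real ?n * h r ^ l + real l * (r * h' r) * h r ^ (l - 1))"
  have dF: "((\<lambda>r. r ^ ?n * h r ^ l) has_real_derivative r ^ (?n - 1) * F' l r) (at r)"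
    if "0 < r" for r l
  proof -
    have "((\<lambda>r. r ^ ?n * h r ^ l) has_real_derivative
        r ^ ?n * (real l * h r ^ (l - 1) * h' r) + real ?n * r ^ (?n - 1) * h r ^ l) (at r)"
      using that by (auto intro!: derivative_eq_intros dh)
    moreover have "r ^ ?n = r ^ (?n - 1) * r" using n1 by (simp add: power_eq_if)
    ultimately show ?thesis by (simp add: F'_def algebra_simps)
  qed
  have SF: "\<exists>x. norm x = r \<and>
      real l * S_minors l (hessian u x) = real ((?n - 1) choose (l - 1)) * F' l r"
    if "0 < r" "1 \<le> l" for r l
    using S[OF that] binomial_radial_identity[OF that(2) n1] by (auto simp: F'_def)
  \<comment> \<open>Holds since \<open>l - 1 \<le> n - 1\<close>; it lets signs and zeros pass from
    \<open>S_minors l\<close> to \<open>F' l\<close>.\<close>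
  have A: "0 < (?n - 1) choose (l - 1)" if "l \<le> k" for l
    using that assms(2) by (simp add: zero_less_binomial)
  have F'_nonneg: "0 \<le> F' l r" if "0 < r" "1 \<le> l" "l \<le> k" for l r
  proof -
    obtain x where "real l * S_minors l (hessian u x) = real ((?n - 1) choose (l - 1)) * F' l r"
      using SF[OF \<open>0 < r\<close> \<open>1 \<le> l\<close>] by blast
    moreover have "0 \<le> S_minors l (hessian u x)"
      using adm that by (auto simp: admissible_def)
    ultimately show ?thesis
      using A[OF that(3)] by (metis mult_nonneg_nonneg of_nat_0_le_iff of_nat_0_less_iff zero_le_mult_iff not_le)
  qed
  have F_mono: "r ^ ?n * h r ^ l \<le> s ^ ?n * h s ^ l" if "0 < r" "r \<le> s" "1 \<le> l" "l \<le> k" for r s l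
  proof (rule DERIV_nonneg_imp_nondecreasing[OF that(2)])
    fix t assume "r \<le> t" "t \<le> s"
    then have "0 < t" using that(1) by simp
    then show "\<exists>y. ((\<lambda>r. r ^ ?n * h r ^ l) has_real_derivative y) (at t) \<and> 0 \<le> y"
      using that
      by (intro exI[of _ "t ^ (?n - 1) * F' l t"] conjI dF mult_nonneg_nonneg F'_nonneg) auto
  qed
  \<comment> \<open>The case \<open>l = 1\<close> of \<open>F_mono\<close>:
    \<open>r ^ n * h r\<close> is nondecreasing and tends to 0 at the origin.\<close>
  have h_nonneg: "0 \<le> h r" if "0 < r" for r
  proof -
    \<comment> \<open>One factor \<open>s\<close> stays with \<open>h s\<close>: for
      \<open>n = 1\<close> the power has limit \<open>0 ^ 0 = 1\<close>, and the limit 0 comes from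
      \<open>lim\<close> alone.\<close>
    have "((\<lambda>s. s ^ (?n - 1) * (s * h s)) \<longlongrightarrow> 0 ^ (?n - 1) * 0) (at_right 0)"
      by (intro tendsto_mult lim tendsto_power tendsto_ident_at)
    then have "((\<lambda>s. s ^ (?n - 1) * (s * h s)) \<longlongrightarrow> 0) (at_right 0)" by simp
    moreover have "\<forall>\<^sub>F s in at_right 0. s ^ (?n - 1) * (s * h s) \<le> r ^ ?n * h r"
      using eventually_at_right_real[OF that]
    proof eventually_elim
      case (elim s)
      moreover have "s ^ ?n = s ^ (?n - 1) * s" using n1 by (simp add: power_eq_if)
      ultimately show ?case using F_mono[of s r 1] assms(1) by (simp add: mult.assoc)
    qed
    ultimately have "0 \<le> r ^ ?n * h r" by (rule tendsto_upperbound) simp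
    then show ?thesis using mult_le_cancel_left_pos[of "r ^ ?n" 0 "h r"] that by simp
  qed
  have h_nz: "h r0 \<noteq> 0" if r0: "0 < r0" for r0
  proof
    assume h0: "h r0 = 0"
    \<comment> \<open>The neighbourhood of radius \<open>r0\<close> around \<open>r0\<close>
      contains positive radii only, so \<open>h_nonneg\<close> makes \<open>r0\<close> a local
      minimum.\<close>
    have "h' r0 = 0"
      by (rule DERIV_local_min[OF dh[OF r0] r0]) (use h0 h_nonneg in auto)
    \<comment> \<open>For \<open>k = 1\<close> the factor \<open>h r0 ^ (k - 1)\<close> is 1, so the
      second summand vanishes through \<open>h' r0 = 0\<close>.\<close>
    then have "F' k r0 = 0" using h0 assms(1) by (simp add: F'_def)
    moreover obtain x where "norm x = r0"
      "real k * S_minors k (hessian u x) = real ((?n - 1) choose (k - 1)) * F' k r0"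
      using SF[OF r0 assms(1)] by blast
    ultimately have "w r0 * g (\<phi> r0) = 0"
      using assms(1) by (simp add: eq u\<phi>)
    then have "g (\<phi> r0) = 0"
      using assms(7) r0 by (metis less_irrefl mult_eq_0_iff)
    have g0: "g (\<phi> r) = 0" if "r0 \<le> r" for r
    proof -
      have "\<phi> r0 \<le> \<phi> r"
      proof (rule DERIV_nonneg_imp_nondecreasing[OF that])
        fix t assume "r0 \<le> t" "t \<le> r"
        then have "0 < t" using r0 by simp
        then show "\<exists>y. (\<phi> has_real_derivative y) (at t) \<and> 0 \<le> y"
          using h_nonneg[of t] by (intro exI[of _ "t * h t"] conjI d\<phi>) auto
      qed
      then have "g (\<phi> r) \<le> g (\<phi> r0)" using assms(5) by (simp add: antimonoD)
      then show ?thesis using assms(4) \<open>g (\<phi> r0) = 0\<close> by (simp add: order_antisym)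
    qed
    have F'0: "F' k r = 0" if "r0 \<le> r" for r
    proof -
      have "0 < r" using r0 that by simp
      obtain x where "norm x = r"
        "real k * S_minors k (hessian u x) = real ((?n - 1) choose (k - 1)) * F' k r"
        using SF[OF \<open>0 < r\<close> assms(1)] by blast
      then show ?thesis using eq[of x] u\<phi>[of x] g0[OF that] A[of k] by simp
    qed
    have h_zero: "h r = 0" if "0 < r" for r
    proof -
      have "r ^ ?n * h r ^ k \<le> 0"
      proof (cases "r \<le> r0")
        case True
        then show ?thesis using F_mono[OF that True assms(1)] h0 assms(1) by (simp add: power_0_left)
      next
        case False
        then have "r0 \<le> r" by simp
        then have "r ^ ?n * h r ^ k \<le> r0 ^ ?n * h r0 ^ k"
        proof (rule DERIV_nonpos_imp_nonincreasing)
          fix t assume t: "r0 \<le> t" "t \<le> r"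
          then show "\<exists>y. ((\<lambda>r. r ^ ?n * h r ^ k) has_real_derivative y) (at t) \<and> y \<le> 0"
            using F'0[of t] r0 by (intro exI[of _ "t ^ (?n - 1) * F' k t"] conjI dF) auto
        qed
        then show ?thesis using h0 assms(1) by (simp add: power_0_left)
      qed
      \<comment> \<open>Together with \<open>0 \<le> h r\<close>, this upper bound forces
        \<open>h r = 0\<close>.\<close>
      then have "h r ^ k \<le> 0" using mult_le_cancel_left_pos[of "r ^ ?n" "h r ^ k" 0] that by simp
      then show ?thesis using h_nonneg[OF that] by (metis less_le zero_less_power not_le)
    qed
    \<comment> \<open>The derivative of \<open>\<phi>\<close> is known to vanish at positive radii;
      continuity on \<open>{0..}\<close> extends the constancy to the origin.\<close>
    have \<phi>_const: "\<phi> r = \<phi> 0" if "0 \<le> r" for r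
    proof (cases "r = 0")
      case False
      show ?thesis
      proof (rule DERIV_isconst_end[of 0 r \<phi>])
        show "0 < r" using that False by simp
        show "continuous_on {0..r} \<phi>" by (rule continuous_on_subset[OF c\<phi>]) auto
        show "(\<phi> has_real_derivative 0) (at t)" if "0 < t" "t < r" for t
          using d\<phi>[OF that(1)] h_zero[OF that(1)] by simp
      qed
    qed simp
    have "u x = \<phi> 0" for x unfolding u\<phi>[of x] by (rule \<phi>_const[OF norm_ge_zero])
    then show False using assms(17) unfolding constant_on_def by blast
  qed
  show ?thesis using grad h_nz by simp
qed

end
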